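(* Let $\mathcal{H}_N$ be a real or complex Hilbert space of finite dimension $N$, and let $W_1,\dots,W_M$ be subspaces of $\mathcal{H}_N$. The following are equivalent: (1) $\{W_i\}_{i=1}^M$ allows phase retrieval in $\mathcal{H}_N$. (2) For every choice, for each $i=1,\dots,M$, of a finite sequence $\{\varphi_{i,j}\}_{j=1}^{J_i}\subset W_i$ which gives norm retrieval in $W_i$, the combined sequence $\{\varphi_{i,j}\}_{j=1,\,i=1}^{J_i,\,M}$ allows phase retrieval in $\mathcal{H}_N$.
   Context: A family of vectors $\{\varphi_i\}_i$ in a Hilbert space $\mathcal{H}$ does (allows) phase retrieval in $\mathcal{H}$ if whenever $x,y\in\mathcal{H}$ satisfy $|\langle x,\varphi_i\rangle|=|\langle y,\varphi_i\rangle|$ for all $i$, then $x=cy$ for some scalar $c$ with $|c|=1$. A family of subspaces $\{W_i\}_{i=1}^M$ of $\mathcal{H}$ does (allows) phase retrieval in $\mathcal{H}$ if, with $P_i$ the orthogonal projection onto $W_i$, whenever $x,y\in\mathcal{H}$ satisfy $\|P_ix\|=\|P_iy\|$ for all $i$, then $x=cy$ for some scalar $c$ with $|c|=1$. A family of vectors $\{\varphi_j\}_{j}$ in a Hilbert space $W$ gives norm retrieval in $W$ if whenever $x,y\in W$ satisfy $|\langle x,\varphi_j\rangle|=|\langle y,\varphi_j\rangle|$ for all $j$, then $\|x\|=\|y\|$. *)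

theory Defs
  imports "HOL-Analysis.Analysis"
begin

text \<open>
  The scalar field, real or complex, treated uniformly. The law for
  \<open>x * conjg x\<close> determines \<open>conjg\<close>; it is the identity on the reals and \<open>cnj\<close> on the
  complex numbers. By Ostrowski's theorem these are, up to isometric isomorphism, the only
  members of the class.
\<close>

class real_or_complex = real_normed_field +
  fixes conjg :: "'a \<Rightarrow> 'a"
  assumes conjg_add: "conjg (x + y) = conjg x + conjg y"
    and mult_conjg: "x * conjg x = (norm x)\<^sup>2 *\<^sub>R 1"

instantiation real :: real_or_complex
begin
definition conjg_real :: "real \<Rightarrow> real" where "conjg_real x = x"
instance by standard (simp_all add: conjg_real_def power2_eq_square)
end

instantiation complex :: real_or_complex
begin
definition conjg_complex :: "complex \<Rightarrow> complex" where "conjg_complex = cnj"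
instance by standard (simp_all add: conjg_complex_def scaleR_conv_of_real flip: complex_norm_square)
end

text \<open>
  The inner product is linear in its first argument. Completeness is not assumed: it is
  automatic in finite dimension, the only case in which the locale is used.
\<close>

locale inner_product_space = vector_space scale
  for scale :: "'k::real_or_complex \<Rightarrow> 'v::ab_group_add \<Rightarrow> 'v" +
  fixes ip :: "'v \<Rightarrow> 'v \<Rightarrow> 'k"
  assumes ip_add_left: "ip (x + y) z = ip x z + ip y z"
    and ip_scale_left: "ip (scale c x) y = c * ip x y"
    and ip_commute: "ip x y = conjg (ip y x)"
    and ip_self: "\<exists>r\<ge>0. ip x x = of_real r"
    and ip_definite: "ip x x = 0 \<Longrightarrow> x = 0"
begin

text \<open>As \<open>ip x x\<close> is a nonnegative real scalar, it agrees with its modulus.\<close>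

definition ip_norm :: "'v \<Rightarrow> real" where
  "ip_norm x = sqrt (norm (ip x x))"

definition orth_proj :: "'v set \<Rightarrow> 'v \<Rightarrow> 'v" where
  "orth_proj W x = (THE p. p \<in> W \<and> (\<forall>w\<in>W. ip (x - p) w = 0))"

definition vectors_phase_retrieval :: "'i set \<Rightarrow> ('i \<Rightarrow> 'v) \<Rightarrow> bool" where
  "vectors_phase_retrieval I \<phi> \<longleftrightarrow>
    (\<forall>x y. (\<forall>i\<in>I. norm (ip x (\<phi> i)) = norm (ip y (\<phi> i))) \<longrightarrow>
      (\<exists>c. norm c = 1 \<and> x = scale c y))"

definition subspaces_phase_retrieval :: "'i set \<Rightarrow> ('i \<Rightarrow> 'v set) \<Rightarrow> bool" where
  "subspaces_phase_retrieval I W \<longleftrightarrow>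
    (\<forall>x y. (\<forall>i\<in>I. ip_norm (orth_proj (W i) x) = ip_norm (orth_proj (W i) y)) \<longrightarrow>
      (\<exists>c. norm c = 1 \<and> x = scale c y))"

definition norm_retrieval :: "'v set \<Rightarrow> 'i set \<Rightarrow> ('i \<Rightarrow> 'v) \<Rightarrow> bool" where
  "norm_retrieval W I \<phi> \<longleftrightarrow>
    (\<forall>x\<in>W. \<forall>y\<in>W. (\<forall>i\<in>I. norm (ip x (\<phi> i)) = norm (ip y (\<phi> i))) \<longrightarrow>
      ip_norm x = ip_norm y)"

end

lemma inner_product_space_real_inner:
  "inner_product_space (scaleR :: real \<Rightarrow> 'a::real_inner \<Rightarrow> 'a) inner"
  by unfold_locales
    (auto simp: algebra_simps conjg_real_def inner_commute)

lemma inner_product_space_complex_vec: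
  "inner_product_space (vector_scalar_mult :: complex \<Rightarrow> complex ^ 'n \<Rightarrow> complex ^ 'n)
    (\<lambda>x y. \<Sum>i\<in>UNIV. x $ i * cnj (y $ i))"
proof -
  have self: "(\<Sum>i\<in>UNIV. x $ i * cnj (x $ i)) = of_real (\<Sum>i\<in>UNIV. (cmod (x $ i))\<^sup>2)"
    for x :: "complex ^ 'n"
    by (simp flip: complex_norm_square)
  show ?thesis
  proof unfold_locales
    fix x :: "complex ^ 'n"
    show "\<exists>r\<ge>0. (\<Sum>i\<in>UNIV. x $ i * cnj (x $ i)) = of_real r"
      unfolding self by (rule exI[of _ "\<Sum>i\<in>UNIV. (cmod (x $ i))\<^sup>2"]) (simp add: sum_nonneg)
    show "x = 0" if "(\<Sum>i\<in>UNIV. x $ i * cnj (x $ i)) = 0"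
      using that unfolding self of_real_eq_0_iff
      by (subst (asm) sum_nonneg_eq_0_iff) (auto simp: vec_eq_iff)
  qed (simp_all add: sum.distrib algebra_simps sum_distrib_left conjg_complex_def)
qed

end

theory Submission
  imports Defs
begin

text \<open>
  Both directions compare \<open>x\<close> and \<open>y\<close> through their projections \<open>P\<^sub>i x\<close> and \<open>P\<^sub>i y\<close> onto \<open>W\<^sub>i\<close>,
  because \<open>\<langle>P\<^sub>i x, w\<rangle> = \<langle>x, w\<rangle>\<close> for \<open>w \<in> W\<^sub>i\<close> (\<open>ip_orth_proj\<close>).

  If vectors of \<open>W\<^sub>i\<close> give norm retrieval there and do not distinguish \<open>x\<close> from \<open>y\<close>, then they do
  not distinguish \<open>P\<^sub>i x\<close> from \<open>P\<^sub>i y\<close>, and so these projections have the same norm. Hence phase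
  retrieval by the subspaces implies phase retrieval by the vectors.

  Conversely, let \<open>\<parallel>P\<^sub>i x\<parallel> = \<parallel>P\<^sub>i y\<parallel>\<close> for all \<open>i\<close>. It suffices to find in each \<open>W\<^sub>i\<close> an orthogonal
  basis that does not distinguish \<open>u = P\<^sub>i x\<close> from \<open>v = P\<^sub>i y\<close>, since an orthogonal basis gives norm
  retrieval by Parseval's identity (\<open>parseval\<close>). Such a basis exists because \<open>u\<close> and \<open>v\<close> have equal
  norms (\<open>ex_orthogonal_basis_equal_moduli\<close>): after multiplying \<open>v\<close> by a unimodular scalar,
  \<open>\<langle>v, u\<rangle>\<close> is real, and then \<open>u + v\<close> and \<open>u - v\<close>, the diagonals of a rhombus, are orthogonal.
  In an orthogonal basis containing those of the two that are nonzero, every member \<open>b\<close> is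
  orthogonal to \<open>u + v\<close> or to \<open>u - v\<close>, that is, \<open>\<langle>u, b\<rangle> = \<plusminus>\<langle>v, b\<rangle>\<close>.
\<close>

section \<open>Conjugation of scalars\<close>

lemma conjg_zero [simp]: "conjg (0 :: 'k::real_or_complex) = 0"
  using conjg_add[of "0::'k" 0] by simp

lemma conjg_of_real [simp]: "conjg (of_real r :: 'k::real_or_complex) = of_real r"
proof (cases "r = 0")
  case False
  have "of_real r * conjg (of_real r :: 'k) = of_real r * of_real r"
    by (simp only: mult_conjg)
      (simp add: power2_eq_square scaleR_conv_of_real flip: of_real_mult)
  with False show ?thesis by simp
qed simp

lemma conjg_mult: "conjg (x * y) = conjg x * conjg (y :: 'k::real_or_complex)"
proof (cases "x * y = 0")
  case False
  have "(x * y) * conjg (x * y) = (x * conjg x) * (y * conjg y)"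
    by (simp only: mult_conjg) (simp add: norm_mult power_mult_distrib)
  then have "(x * y) * conjg (x * y) = (x * y) * (conjg x * conjg y)"
    by (simp add: algebra_simps)
  with False show ?thesis by (metis mult_left_cancel)
qed auto

lemma norm_conjg [simp]: "norm (conjg x) = norm (x :: 'k::real_or_complex)"
proof (cases "x = 0")
  case False
  have "norm x * norm (conjg x) = norm x * norm x"
    by (simp only: mult_conjg flip: norm_mult) (simp add: power2_eq_square norm_mult)
  with False show ?thesis by simp
qed simp

lemma ex_unimodular_mult_eq_norm:
  "\<exists>c::'k::real_or_complex. norm c = 1 \<and> c * t = of_real (norm t)"
proof (cases "t = 0")
  case True
  then show ?thesis by (intro exI[of _ 1]) simp
next
  case False
  have "conjg t / of_real (norm t) * t = of_real (norm t)"
    using mult_conjg[of t] False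
    by (simp add: field_simps power2_eq_square scaleR_conv_of_real)
  moreover have "norm (conjg t / of_real (norm t)) = 1"
    using False by (simp add: norm_divide)
  ultimately show ?thesis by blast
qed

section \<open>Orthogonal families\<close>

context inner_product_space
begin

lemma ip_zero_left [simp]: "ip 0 y = 0"
  using ip_scale_left[of 0 0 y] by simp

lemma ip_diff_left: "ip (x - y) z = ip x z - ip y z"
  using ip_add_left[of "x - y" y z] by simp

lemma ip_sum_left: "ip (sum f A) z = (\<Sum>a\<in>A. ip (f a) z)"
  by (induction A rule: infinite_finite_induct) (auto simp: ip_add_left)

lemma ip_eq_zero_commute: "ip x y = 0 \<longleftrightarrow> ip y x = 0"
  by (metis conjg_zero ip_commute)

lemma ip_zero_right [simp]: "ip x 0 = 0"
  by (simp add: ip_eq_zero_commute[of x])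

lemma ip_self_eq_zero_iff [simp]: "ip x x = 0 \<longleftrightarrow> x = 0"
  by (metis ip_definite ip_zero_left)

lemma ip_add_right: "ip x (y + z) = ip x y + ip x z"
  by (metis conjg_add ip_add_left ip_commute)

lemma ip_scale_right: "ip x (scale c y) = conjg c * ip x y"
  by (metis conjg_mult ip_commute ip_scale_left)

lemma ip_self_scale_unimodular: "norm c = 1 \<Longrightarrow> ip (scale c x) (scale c x) = ip x x"
  using mult_conjg[of c] by (simp add: ip_scale_left ip_scale_right mult.assoc[symmetric] mult.commute[of "conjg c"])

lemma ip_norm_eq_iff: "ip_norm x = ip_norm y \<longleftrightarrow> ip x x = ip y y"
  unfolding ip_norm_def using ip_self[of x] ip_self[of y] by auto

lemma ip_zero_span:
  assumes "w \<in> span B" "\<And>b. b \<in> B \<Longrightarrow> ip x b = 0"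
  shows "ip x w = 0"
  using assms(1)
  by (induction rule: span_induct_alt) (auto simp: assms(2) ip_add_right ip_scale_right)

text \<open>
  The lengths of the members are left arbitrary so that sums and differences of given vectors
  can be members as they stand; the expansions below divide by \<open>ip b b\<close>, whence \<open>0 \<notin> B\<close>.
\<close>

definition orthogonal_set :: "'v set \<Rightarrow> bool" where
  "orthogonal_set B \<longleftrightarrow> 0 \<notin> B \<and> (\<forall>a\<in>B. \<forall>b\<in>B. a \<noteq> b \<longrightarrow> ip a b = 0)"

definition fourier_sum :: "'v set \<Rightarrow> 'v \<Rightarrow> 'v" where
  "fourier_sum B x = (\<Sum>b\<in>B. scale (ip x b / ip b b) b)"

lemma fourier_sum_in_span: "fourier_sum B x \<in> span B"
  unfolding fourier_sum_def by (intro span_sum span_scale span_base)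

lemma ip_sum_orthogonal:
  assumes "orthogonal_set B" "finite B" "b \<in> B"
  shows "ip (\<Sum>a\<in>B. scale (f a) a) b = f b * ip b b"
proof -
  have "ip (\<Sum>a\<in>B. scale (f a) a) b = (\<Sum>a\<in>B. if a = b then f b * ip b b else 0)"
    unfolding ip_sum_left
    using assms by (intro sum.cong) (auto simp: orthogonal_set_def ip_scale_left)
  with assms show ?thesis by simp
qed

lemma ip_fourier_residual:
  assumes "orthogonal_set B" "finite B" "w \<in> span B"
  shows "ip (x - fourier_sum B x) w = 0"
proof (rule ip_zero_span[OF assms(3)])
  fix b assume "b \<in> B"
  moreover from this have "ip b b \<noteq> 0" using assms(1) by (auto simp: orthogonal_set_def)
  ultimately show "ip (x - fourier_sum B x) b = 0"
    using assms by (simp add: ip_diff_left fourier_sum_def ip_sum_orthogonal)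
qed

lemma fourier_sum_eq:
  assumes "orthogonal_set B" "finite B" "x \<in> span B"
  shows "fourier_sum B x = x"
proof -
  have "x - fourier_sum B x \<in> span B"
    using assms(3) fourier_sum_in_span by (rule span_diff)
  then have "ip (x - fourier_sum B x) (x - fourier_sum B x) = 0"
    by (rule ip_fourier_residual[OF assms(1,2)])
  then show ?thesis by simp
qed

lemma parseval:
  assumes "orthogonal_set B" "finite B" "x \<in> span B"
  shows "ip x x = (\<Sum>b\<in>B. of_real ((norm (ip x b))\<^sup>2) / ip b b)"
proof -
  have "ip x x = ip (fourier_sum B x) x"
    using fourier_sum_eq[OF assms] by simp
  also have "\<dots> = (\<Sum>b\<in>B. ip x b * conjg (ip x b) / ip b b)"
    unfolding fourier_sum_def ip_sum_left
    by (intro sum.cong) (simp_all add: ip_scale_left flip: ip_commute)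
  finally show ?thesis by (simp add: mult_conjg scaleR_conv_of_real)
qed

lemma norm_retrieval_orthogonal_basis:
  assumes "orthogonal_set B" "finite B" "W \<subseteq> span B" "B \<subseteq> \<phi> ` I"
  shows "norm_retrieval W I \<phi>"
  unfolding norm_retrieval_def
proof (intro ballI impI)
  fix x y
  assume "x \<in> W" "y \<in> W" and eq: "\<forall>i\<in>I. norm (ip x (\<phi> i)) = norm (ip y (\<phi> i))"
  have "norm (ip x b) = norm (ip y b)" if "b \<in> B" for b
    using that assms(4) eq by auto
  then have "ip x x = ip y y"
    using assms(3) \<open>x \<in> W\<close> \<open>y \<in> W\<close> by (simp add: parseval[OF assms(1,2)] subset_iff)
  then show "ip_norm x = ip_norm y" by (simp add: ip_norm_eq_iff)
qed

lemma independent_orthogonal_set: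
  assumes "orthogonal_set B" "finite B"
  shows "independent B"
proof (rule independent_if_scalars_zero[OF assms(2)])
  fix f b assume "(\<Sum>a\<in>B. scale (f a) a) = 0" and "b \<in> B"
  then have "f b * ip b b = 0"
    using ip_sum_orthogonal[OF assms, of b f] by simp
  with assms(1) \<open>b \<in> B\<close> show "f b = 0" by (auto simp: orthogonal_set_def)
qed

text \<open>
  For equal norms, \<open>\<langle>u - c v, u + c v\<rangle>\<close> reduces to \<open>\<langle>u, c v\<rangle> - \<langle>c v, u\<rangle>\<close>, which vanishes when
  \<open>\<langle>c v, u\<rangle>\<close> is real. The scalar \<open>c\<close> cancels the phase of \<open>\<langle>v, u\<rangle>\<close>.
\<close>

lemma ex_unimodular_orthogonal_sum_diff:
  assumes "ip u u = ip v v"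
  shows "\<exists>c. norm c = 1 \<and> ip (u - scale c v) (u + scale c v) = 0"
proof -
  obtain c where c: "norm c = 1" "c * ip v u = of_real (norm (ip v u))"
    using ex_unimodular_mult_eq_norm by blast
  have "ip (scale c v) u = of_real (norm (ip v u))"
    using c by (simp add: ip_scale_left)
  then have "ip u (scale c v) = ip (scale c v) u"
    by (metis conjg_of_real ip_commute)
  with assms c(1) have "ip (u - scale c v) (u + scale c v) = 0"
    by (simp add: ip_diff_left ip_add_right ip_self_scale_unimodular)
  with c(1) show ?thesis by blast
qed

end

section \<open>Orthogonal bases and projections in finite dimension\<close>

locale finite_dimensional_inner_product_space =
  inner_product_space scale ip + finite_dimensional_vector_space scale Basis
  for scale :: "'k::real_or_complex \<Rightarrow> 'v::ab_group_add \<Rightarrow> 'v"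
    and ip :: "'v \<Rightarrow> 'v \<Rightarrow> 'k"
    and Basis :: "'v set"
begin

text \<open>
  One Gram--Schmidt step enlarges any orthogonal set that does not yet span \<open>W\<close>; independence
  bounds the number of such steps by the dimension.
\<close>

lemma ex_orthogonal_basis_extension:
  assumes "subspace W" "orthogonal_set S" "finite S" "S \<subseteq> W"
  shows "\<exists>B. S \<subseteq> B \<and> B \<subseteq> W \<and> finite B \<and> orthogonal_set B \<and> W \<subseteq> span B"
  using assms(2-)
proof (induction "dimension - card S" arbitrary: S rule: less_induct)
  case less
  show ?case
  proof (cases "W \<subseteq> span S")
    case True
    with less.prems show ?thesis by blast
  next
    case False
    then obtain w where w: "w \<in> W" "w \<notin> span S" by blast
    define r where "r = w - fourier_sum S w"
    have "span S \<subseteq> W" using less.prems assms(1) by (simp add: span_minimal)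
    then have "r \<in> W"
      using w fourier_sum_in_span assms(1) unfolding r_def by (blast intro: subspace_diff)
    have "r \<notin> span S"
      using w(2) fourier_sum_in_span[of S w] span_add[of r S "fourier_sum S w"]
      by (auto simp: r_def)
    then have "r \<noteq> 0" "r \<notin> S" by (auto simp: span_zero span_base)
    have "ip r s = 0" "ip s r = 0" if "s \<in> S" for s
    proof -
      show "ip r s = 0"
        unfolding r_def using less.prems that by (intro ip_fourier_residual span_base)
      then show "ip s r = 0" by (simp add: ip_eq_zero_commute)
    qed
    then have orth: "orthogonal_set (insert r S)"
      using less.prems(1) \<open>r \<noteq> 0\<close> by (auto simp: orthogonal_set_def)
    then have "card (insert r S) \<le> dimension"
      using less.prems(2) by (metis dim_UNIV dim_subset_UNIV finite_insert
          dim_eq_card_independent independent_orthogonal_set)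
    then have "dimension - card (insert r S) < dimension - card S"
      using \<open>r \<notin> S\<close> less.prems(2) by simp
    from less.hyps[OF this orth] show ?thesis
      using less.prems \<open>r \<in> W\<close> by auto
  qed
qed

lemma ex1_orthogonal_projection:
  assumes "subspace W"
  shows "\<exists>!p. p \<in> W \<and> (\<forall>w\<in>W. ip (x - p) w = 0)"
proof -
  obtain B where B: "B \<subseteq> W" "finite B" "orthogonal_set B" "W \<subseteq> span B"
    using ex_orthogonal_basis_extension[OF assms, of "{}"] by (auto simp: orthogonal_set_def)
  show ?thesis
  proof (rule ex1I[of _ "fourier_sum B x"])
    have "fourier_sum B x \<in> W"
      using fourier_sum_in_span B(1) assms by (meson span_minimal subsetD)
    then show "fourier_sum B x \<in> W \<and> (\<forall>w\<in>W. ip (x - fourier_sum B x) w = 0)"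
      using B by (auto intro: ip_fourier_residual)
    fix p assume p: "p \<in> W \<and> (\<forall>w\<in>W. ip (x - p) w = 0)"
    let ?d = "p - fourier_sum B x"
    have "?d \<in> W" using p \<open>fourier_sum B x \<in> W\<close> assms by (blast intro: subspace_diff)
    then have "ip (x - p) ?d = 0" "ip (x - fourier_sum B x) ?d = 0"
      using p B by (auto intro: ip_fourier_residual)
    then have "ip ?d ?d = 0" by (simp add: ip_diff_left)
    then show "p = fourier_sum B x" by simp
  qed
qed

lemma orth_proj_in: "subspace W \<Longrightarrow> orth_proj W x \<in> W"
  unfolding orth_proj_def using theI'[OF ex1_orthogonal_projection] by blast

lemma ip_orth_proj:
  assumes "subspace W" "w \<in> W"
  shows "ip (orth_proj W x) w = ip x w"
proof -
  have "ip (x - orth_proj W x) w = 0"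
    unfolding orth_proj_def using theI'[OF ex1_orthogonal_projection[OF assms(1)]] assms(2) by blast
  then show ?thesis by (simp add: ip_diff_left)
qed

lemma ex_orthogonal_basis_equal_moduli:
  assumes "subspace W" "u \<in> W" "v \<in> W" "ip_norm u = ip_norm v"
  shows "\<exists>B\<subseteq>W. finite B \<and> orthogonal_set B \<and> W \<subseteq> span B \<and>
    (\<forall>b\<in>B. norm (ip u b) = norm (ip v b))"
proof -
  obtain c where c: "norm c = 1" and "ip (u - scale c v) (u + scale c v) = 0"
    using ex_unimodular_orthogonal_sum_diff assms(4) ip_norm_eq_iff by blast
  moreover define s d where "s = u + scale c v" and "d = u - scale c v"
  ultimately have ds: "ip d s = 0" "ip s d = 0" by (auto simp: ip_eq_zero_commute)
  have "s \<in> W" "d \<in> W"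
    unfolding s_def d_def using assms(1-3)
    by (auto intro: subspace_add subspace_diff subspace_scale)
  \<comment> \<open>If \<open>u\<close> and \<open>v\<close> are proportional, then \<open>s\<close> or \<open>d\<close> may be zero.\<close>
  moreover have "orthogonal_set ({s, d} - {0})"
    using ds by (auto simp: orthogonal_set_def)
  ultimately obtain B where B: "{s, d} - {0} \<subseteq> B" "B \<subseteq> W" "finite B" "orthogonal_set B"
      "W \<subseteq> span B"
    using ex_orthogonal_basis_extension[OF assms(1), of "{s, d} - {0}"] by auto
  have "norm (ip u b) = norm (ip v b)" if "b \<in> B" for b
  proof -
    have "ip s b = 0 \<or> ip d b = 0"
    proof (cases "b = s")
      case False
      then have "s = 0 \<or> ip s b = 0"
        using B(1,4) that by (auto simp: orthogonal_set_def)
      then show ?thesis by auto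
    qed (simp add: ds)
    then have "ip u b = - (c * ip v b) \<or> ip u b = c * ip v b"
      by (auto simp: s_def d_def ip_add_left ip_diff_left ip_scale_left add_eq_0_iff2)
    then show ?thesis using c by (auto simp: norm_mult)
  qed
  with B show ?thesis by blast
qed

section \<open>Phase retrieval by subspaces and by vectors\<close>

lemma vectors_phase_retrievalI:
  assumes "subspaces_phase_retrieval I W"
    and "\<And>i. i \<in> I \<Longrightarrow> subspace (W i)"
    and "\<And>i j. i \<in> I \<Longrightarrow> j \<in> J i \<Longrightarrow> \<phi> i j \<in> W i"
    and "\<And>i. i \<in> I \<Longrightarrow> norm_retrieval (W i) (J i) (\<phi> i)"
  shows "vectors_phase_retrieval (Sigma I J) (\<lambda>(i, j). \<phi> i j)"
  unfolding vectors_phase_retrieval_def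
proof (intro allI impI)
  fix x y
  assume eq: "\<forall>p\<in>Sigma I J. norm (ip x (case p of (i, j) \<Rightarrow> \<phi> i j)) =
    norm (ip y (case p of (i, j) \<Rightarrow> \<phi> i j))"
  have "ip_norm (orth_proj (W i) x) = ip_norm (orth_proj (W i) y)" if "i \<in> I" for i
  proof -
    have "norm (ip (orth_proj (W i) x) (\<phi> i j)) = norm (ip (orth_proj (W i) y) (\<phi> i j))"
      if "j \<in> J i" for j
      using assms(2,3) eq that \<open>i \<in> I\<close> by (auto simp: ip_orth_proj)
    then show ?thesis
      using assms(4)[OF that] orth_proj_in[OF assms(2)[OF that]]
      unfolding norm_retrieval_def by blast
  qed
  then show "\<exists>c. norm c = 1 \<and> x = scale c y"
    using assms(1) unfolding subspaces_phase_retrieval_def by blast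
qed

lemma subspaces_phase_retrievalI:
  assumes "\<And>i. i \<in> I \<Longrightarrow> subspace (W i)"
    and vec: "\<And>(J :: 'i \<Rightarrow> nat) \<phi>. (\<And>i j. i \<in> I \<Longrightarrow> j \<in> {1..J i} \<Longrightarrow> \<phi> i j \<in> W i) \<Longrightarrow>
      (\<And>i. i \<in> I \<Longrightarrow> norm_retrieval (W i) {1..J i} (\<phi> i)) \<Longrightarrow>
      vectors_phase_retrieval (SIGMA i:I. {1..J i}) (\<lambda>(i, j). \<phi> i j)"
  shows "subspaces_phase_retrieval I W"
  unfolding subspaces_phase_retrieval_def
proof (intro allI impI)
  fix x y
  assume eq: "\<forall>i\<in>I. ip_norm (orth_proj (W i) x) = ip_norm (orth_proj (W i) y)"
  have "\<exists>B\<subseteq>W i. finite B \<and> orthogonal_set B \<and> W i \<subseteq> span B \<and>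
      (\<forall>b\<in>B. norm (ip x b) = norm (ip y b))" if i: "i \<in> I" for i
  proof -
    obtain B where B: "B \<subseteq> W i" "finite B" "orthogonal_set B" "W i \<subseteq> span B"
      "\<forall>b\<in>B. norm (ip (orth_proj (W i) x) b) = norm (ip (orth_proj (W i) y) b)"
      using ex_orthogonal_basis_equal_moduli[OF assms(1)[OF i]] orth_proj_in[OF assms(1)[OF i]]
        eq i by metis
    from B(1,5) have "\<forall>b\<in>B. norm (ip x b) = norm (ip y b)"
      using ip_orth_proj[OF assms(1)[OF i]] by (metis subsetD)
    with B show ?thesis by blast
  qed
  then obtain B where B: "\<And>i. i \<in> I \<Longrightarrow> B i \<subseteq> W i \<and> finite (B i) \<and> orthogonal_set (B i) \<and>
      W i \<subseteq> span (B i) \<and> (\<forall>b\<in>B i. norm (ip x b) = norm (ip y b))"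
    by metis
  have "\<forall>i. \<exists>h. i \<in> I \<longrightarrow> bij_betw h {1..card (B i)} (B i)"
    using B ex_bij_betw_nat_finite_1 by blast
  then obtain \<phi> where "\<And>i. i \<in> I \<Longrightarrow> bij_betw (\<phi> i) {1..card (B i)} (B i)"
    by metis
  then have img: "\<phi> i ` {1..card (B i)} = B i" if "i \<in> I" for i
    using that by (simp add: bij_betw_def)
  have "vectors_phase_retrieval (SIGMA i:I. {1..card (B i)}) (\<lambda>(i, j). \<phi> i j)"
  proof (rule vec)
    show "\<phi> i j \<in> W i" if "i \<in> I" "j \<in> {1..card (B i)}" for i j
      using B[OF that(1)] img[OF that(1)] that(2) by blast
    show "norm_retrieval (W i) {1..card (B i)} (\<phi> i)" if "i \<in> I" for i
      using B[OF that] img[OF that] by (intro norm_retrieval_orthogonal_basis[of "B i"]) auto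
  qed
  moreover have "norm (ip x (\<phi> i j)) = norm (ip y (\<phi> i j))"
    if "i \<in> I" "j \<in> {1..card (B i)}" for i j
    using B[OF that(1)] img[OF that(1)] that(2) by blast
  ultimately show "\<exists>c. norm c = 1 \<and> x = scale c y"
    unfolding vectors_phase_retrieval_def by (force simp: split_beta)
qed

end

theorem theorem3p15:
  fixes scale :: "'k::real_or_complex \<Rightarrow> 'v::ab_group_add \<Rightarrow> 'v"
    and ip :: "'v \<Rightarrow> 'v \<Rightarrow> 'k"
    and Basis :: "'v set"
    and N M :: nat
    and W :: "nat \<Rightarrow> 'v set"
  assumes "inner_product_space scale ip"
    and "finite_dimensional_vector_space scale Basis"
    and "vector_space.dim scale (UNIV :: 'v set) = N"
    and "\<And>i. i \<in> {1..M} \<Longrightarrow> module.subspace scale (W i)"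
  shows "inner_product_space.subspaces_phase_retrieval scale ip {1..M} W \<longleftrightarrow>
    (\<forall>(J :: nat \<Rightarrow> nat) (\<phi> :: nat \<Rightarrow> nat \<Rightarrow> 'v).
      (\<forall>i\<in>{1..M}. (\<forall>j\<in>{1..J i}. \<phi> i j \<in> W i) \<and>
        inner_product_space.norm_retrieval ip (W i) {1..J i} (\<phi> i)) \<longrightarrow>
      inner_product_space.vectors_phase_retrieval scale ip
        (SIGMA i:{1..M}. {1..J i}) (\<lambda>(i, j). \<phi> i j))"
proof -
  interpret finite_dimensional_inner_product_space scale ip Basis
    using assms(1,2) by (simp add: finite_dimensional_inner_product_space_def)
  show ?thesis
  proof (intro iffI allI impI)
    fix J :: "nat \<Rightarrow> nat" and \<phi> :: "nat \<Rightarrow> nat \<Rightarrow> 'v"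
    assume "subspaces_phase_retrieval {1..M} W"
      and "\<forall>i\<in>{1..M}. (\<forall>j\<in>{1..J i}. \<phi> i j \<in> W i) \<and> norm_retrieval (W i) {1..J i} (\<phi> i)"
    then show "vectors_phase_retrieval (SIGMA i:{1..M}. {1..J i}) (\<lambda>(i, j). \<phi> i j)"
      by (intro vectors_phase_retrievalI[of _ W] assms(4)) blast+
  next
    assume "\<forall>(J :: nat \<Rightarrow> nat) (\<phi> :: nat \<Rightarrow> nat \<Rightarrow> 'v).
      (\<forall>i\<in>{1..M}. (\<forall>j\<in>{1..J i}. \<phi> i j \<in> W i) \<and> norm_retrieval (W i) {1..J i} (\<phi> i)) \<longrightarrow>
      vectors_phase_retrieval (SIGMA i:{1..M}. {1..J i}) (\<lambda>(i, j). \<phi> i j)"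
    then show "subspaces_phase_retrieval {1..M} W"
      by (intro subspaces_phase_retrievalI assms(4)) blast+
  qed
qed

end
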